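(* There is no finite simple connected graph $G$ that is both $\alpha^-$-stable and square-stable, where square-stable means $\alpha(G)=\alpha(G^2)$.
   Context: $G^2$ is the graph on $V(G)$ in which distinct vertices $v,w$ are adjacent iff $\mathrm{dist}_G(v,w)\le 2$. $\alpha(G)$ is the maximum cardinality of a stable (independent) set. $G$ is $\alpha^-$-stable if $\alpha(G-e)=\alpha(G)$ for every edge $e\in E(G)$, where $G-e$ is obtained by deleting the edge $e$.
   Formalization: The graph G is additionally required to have at least two vertices, because the one-vertex graph is connected, vacuously α⁻-stable and square-stable, and so refutes the claim as literally worded. *)

theory Defs
  imports Main "HOL-Library.Extended_Nat"
begin

text \<open>
  A graph is given by its vertex set and its edge set; an edge is the two-element set of
  its endpoints.
\<close>

definition simple_graph :: "'a set \<Rightarrow> 'a set set \<Rightarrow> bool" where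
  "simple_graph V E \<longleftrightarrow> finite V \<and> (\<forall>e\<in>E. e \<subseteq> V \<and> card e = 2)"

definition adj_rel :: "'a set set \<Rightarrow> ('a \<times> 'a) set" where
  "adj_rel E = {(u, v). {u, v} \<in> E}"

definition connected_graph :: "'a set \<Rightarrow> 'a set set \<Rightarrow> bool" where
  "connected_graph V E \<longleftrightarrow> V \<noteq> {} \<and> (\<forall>u\<in>V. \<forall>v\<in>V. (u, v) \<in> (adj_rel E)\<^sup>*)"

text \<open>
  The least length of a walk from \<open>u\<close> to \<open>v\<close>; it is \<open>\<infinity>\<close> if there is none, as the infimum
  of the empty set.
\<close>

definition graph_dist :: "'a set set \<Rightarrow> 'a \<Rightarrow> 'a \<Rightarrow> enat" where
  "graph_dist E u v = (INF n\<in>{n. (u, v) \<in> adj_rel E ^^ n}. enat n)"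

definition square_edges :: "'a set \<Rightarrow> 'a set set \<Rightarrow> 'a set set" where
  "square_edges V E = {{v, w} | v w. v \<in> V \<and> w \<in> V \<and> v \<noteq> w \<and> graph_dist E v w \<le> 2}"

definition stable_set :: "'a set \<Rightarrow> 'a set set \<Rightarrow> 'a set \<Rightarrow> bool" where
  "stable_set V E S \<longleftrightarrow> S \<subseteq> V \<and> (\<forall>u\<in>S. \<forall>v\<in>S. {u, v} \<notin> E)"

definition stability_number :: "'a set \<Rightarrow> 'a set set \<Rightarrow> nat" where
  "stability_number V E = Max (card ` {S. stable_set V E S})"

definition alpha_minus_stable :: "'a set \<Rightarrow> 'a set set \<Rightarrow> bool" where
  "alpha_minus_stable V E \<longleftrightarrow>
     (\<forall>e\<in>E. stability_number V (E - {e}) = stability_number V E)"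

definition square_stable :: "'a set \<Rightarrow> 'a set set \<Rightarrow> bool" where
  "square_stable V E \<longleftrightarrow> stability_number V E = stability_number V (square_edges V E)"

text \<open>
  The one-vertex graph has no edge to delete, so it is vacuously \<open>\<alpha>\<^sup>-\<close>-stable, and it equals its
  own square. Nonexistence results must therefore exclude it.
\<close>

lemma one_vertex_graph:
  "simple_graph {x} {}" "connected_graph {x} {}"
  "alpha_minus_stable {x} {}" "square_stable {x} {}"
proof -
  have "square_edges {x} {} = {}"
    by (auto simp: square_edges_def)
  then show "square_stable {x} {}"
    by (simp add: square_stable_def)
qed (auto simp: simple_graph_def connected_graph_def alpha_minus_stable_def)

end

theory Submission
  imports Defs
begin

text \<open>
  A maximum stable set \<open>S\<close> of the square of \<open>G\<close> is stable in \<open>G\<close>, and no vertex of \<open>G\<close> has two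
  neighbours in \<open>S\<close>, because two such neighbours would be at distance at most two. By
  connectedness some edge \<open>e = {s, x}\<close> has an end \<open>s \<in> S\<close>. Deleting \<open>e\<close> removes the only
  adjacency between \<open>x\<close> and \<open>S\<close>, so \<open>insert x S\<close> is stable in \<open>G - e\<close>, which gives
  \<open>\<alpha>(G - e) > \<alpha>(G\<^sup>2)\<close>. If \<open>\<alpha>(G\<^sup>2) = \<alpha>(G)\<close>, then \<open>e\<close> witnesses that \<open>G\<close> is not
  \<open>\<alpha>\<^sup>-\<close>-stable.
\<close>

lemma finite_stable_sets:
  assumes "finite V"
  shows "finite {S. stable_set V E S}"
  by (rule finite_subset[of _ "Pow V"]) (auto simp: stable_set_def assms)

lemma card_le_stability_number:
  assumes "finite V" "stable_set V E S"
  shows "card S \<le> stability_number V E"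
  unfolding stability_number_def
  using assms finite_stable_sets[of V E] by (intro Max_ge) auto

lemma obtain_maximum_stable_set:
  assumes "finite V"
  obtains S where "stable_set V E S" "card S = stability_number V E"
proof -
  have "stable_set V E {}"
    by (simp add: stable_set_def)
  then have "stability_number V E \<in> card ` {S. stable_set V E S}"
    unfolding stability_number_def
    using finite_stable_sets[OF assms, of E] by (intro Max_in) auto
  then show thesis
    using that by auto
qed

lemma graph_dist_le_walk_length:
  assumes "(u, v) \<in> adj_rel E ^^ n"
  shows "graph_dist E u v \<le> enat n"
  unfolding graph_dist_def using assms by (intro INF_lower) simp

lemma edge_in_square_edges:
  assumes "simple_graph V E" "{u, v} \<in> E"
  shows "{u, v} \<in> square_edges V E"
proof -
  have "u \<in> V" "v \<in> V" "u \<noteq> v"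
    using assms by (auto simp: simple_graph_def)
  moreover have "graph_dist E u v \<le> 2"
  proof -
    have "graph_dist E u v \<le> enat 1"
      using assms(2) by (intro graph_dist_le_walk_length) (simp add: adj_rel_def)
    also have "\<dots> \<le> 2"
      by (simp add: numeral_eq_enat)
    finally show ?thesis .
  qed
  ultimately show ?thesis
    by (auto simp: square_edges_def)
qed

lemma common_neighbour_in_square_edges:
  assumes "simple_graph V E" "{u, x} \<in> E" "{x, v} \<in> E" "u \<noteq> v"
  shows "{u, v} \<in> square_edges V E"
proof -
  have "u \<in> V" "v \<in> V"
    using assms by (auto simp: simple_graph_def)
  moreover have "graph_dist E u v \<le> 2"
  proof -
    have "(u, v) \<in> adj_rel E ^^ 2"
      using assms(2,3) by (auto simp: numeral_2_eq_2 adj_rel_def)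
    then show ?thesis
      using graph_dist_le_walk_length by (fastforce simp: numeral_eq_enat)
  qed
  ultimately show ?thesis
    using assms(4) by (auto simp: square_edges_def)
qed

lemma connected_graph_has_neighbour:
  assumes "connected_graph V E" "card V \<ge> 2" "s \<in> V"
  obtains x where "{s, x} \<in> E"
proof -
  have "V \<noteq> {s}"
    using assms(2) by auto
  then obtain t where "t \<in> V" "t \<noteq> s"
    using assms(3) by blast
  then have "(s, t) \<in> (adj_rel E)\<^sup>*" "s \<noteq> t"
    using assms by (auto simp: connected_graph_def)
  then obtain x where "(s, x) \<in> adj_rel E"
    by (meson converse_rtranclE)
  then show thesis
    using that by (simp add: adj_rel_def)
qed

text \<open>
  An edge at \<open>s\<close> is the only edge between its other end and a set containing \<open>s\<close> that is stable in
  the square: any further neighbour in the set would be at distance at most two from \<open>s\<close>.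
\<close>

lemma square_stable_set_insert_neighbour:
  assumes "simple_graph V E" "stable_set V (square_edges V E) S" "s \<in> S" "{s, x} \<in> E"
  shows "x \<notin> S" "stable_set V (E - {{s, x}}) (insert x S)"
proof -
  have sq: "{u, v} \<notin> square_edges V E" if "u \<in> S" "v \<in> S" for u v
    using assms(2) that by (simp add: stable_set_def)
  show "x \<notin> S"
    using sq[OF assms(3)] edge_in_square_edges[OF assms(1,4)] by blast
  have no_loop: "{x, x} \<notin> E"
    using assms(1) by (auto simp: simple_graph_def)
  have inner: "{u, v} \<notin> E" if "u \<in> S" "v \<in> S" for u v
    using sq[OF that] edge_in_square_edges[OF assms(1)] by blast
  have outer: "v = s" if "v \<in> S" "{x, v} \<in> E" for v
    using sq[OF assms(3) that(1)]
      common_neighbour_in_square_edges[OF assms(1,4) that(2)] by blast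
  have "insert x S \<subseteq> V"
    using assms by (auto simp: stable_set_def simple_graph_def)
  then show "stable_set V (E - {{s, x}}) (insert x S)"
    using no_loop inner outer by (auto simp: stable_set_def insert_commute)
qed

lemma stability_number_square_less_delete_edge:
  assumes "simple_graph V E" "connected_graph V E" "card V \<ge> 2"
  obtains e where "e \<in> E"
    "stability_number V (square_edges V E) < stability_number V (E - {e})"
proof -
  have fin: "finite V"
    using assms(1) by (simp add: simple_graph_def)
  obtain S where S: "stable_set V (square_edges V E) S"
    and card_S: "card S = stability_number V (square_edges V E)"
    using obtain_maximum_stable_set[OF fin] by blast
  have "S \<subseteq> V"
    using S by (simp add: stable_set_def)
  then have "finite S"
    using fin by (rule finite_subset)
  have "S \<noteq> {}"
  proof -
    obtain v where "v \<in> V"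
      using assms(2) by (auto simp: connected_graph_def)
    then have "stable_set V (square_edges V E) {v}"
      by (auto simp: stable_set_def square_edges_def doubleton_eq_iff)
    then have "1 \<le> card S"
      using card_le_stability_number[OF fin] card_S by fastforce
    then show ?thesis
      by auto
  qed
  then obtain s where "s \<in> S"
    by blast
  then obtain x where e: "{s, x} \<in> E"
    using connected_graph_has_neighbour[OF assms(2,3)] \<open>S \<subseteq> V\<close> by blast
  note ins = square_stable_set_insert_neighbour[OF assms(1) S \<open>s \<in> S\<close> e]
  have "card S < card (insert x S)"
    using \<open>finite S\<close> ins(1) by simp
  also have "\<dots> \<le> stability_number V (E - {{s, x}})"
    using fin ins(2) by (rule card_le_stability_number)
  finally show thesis
    using that[OF e] card_S by simp
qed

theorem corollary2p9:
  "\<not> (\<exists>(V :: 'a set) E. simple_graph V E \<and> connected_graph V E \<and> card V \<ge> 2 \<and>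
        alpha_minus_stable V E \<and> square_stable V E)"
proof
  assume "\<exists>(V :: 'a set) E. simple_graph V E \<and> connected_graph V E \<and> card V \<ge> 2 \<and>
        alpha_minus_stable V E \<and> square_stable V E"
  then obtain V :: "'a set" and E where
    G: "simple_graph V E" "connected_graph V E" "card V \<ge> 2"
    and stable: "alpha_minus_stable V E" "square_stable V E"
    by blast
  obtain e where "e \<in> E"
    "stability_number V (square_edges V E) < stability_number V (E - {e})"
    using stability_number_square_less_delete_edge[OF G] .
  then show False
    using stable by (simp add: alpha_minus_stable_def square_stable_def)
qed

end
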